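(* For each integer $r \ge 2$ there is a constant $c_r$, with $c_r = (1+o(1))\frac{\sqrt{r}}{2}$ as $r \to \infty$, and an online algorithm that $r$-colors the edges of the online random edge process on $n$ vertices such that for any $\epsilon > 0$ there is $c_\epsilon>0$ for which, with high probability, after $(c_r + \epsilon)n$ rounds every color class contains a connected component of order at least $c_\epsilon n$.
   Context: Online random edge process: there are $n$ vertices and a sequence of rounds; in each round one edge arrives, chosen uniformly at random among all pairs of distinct vertices, independently of previous rounds (repetitions are possible). The algorithm must color each edge with one of $r$ colors upon arrival, using only the history so far. "With high probability" means with probability tending to $1$ as $n\to\infty$. *)

theory Defs
  imports "HOL-Probability.Probability" "HOL-Library.Landau_Symbols"
begin

type_synonym edge = "nat set"

definition all_edges :: "nat \<Rightarrow> edge set" where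
  "all_edges n = {e. e \<subseteq> {..<n} \<and> card e = 2}"

(* Vertex sets of the connected components of the graph (V, E), isolated vertices included.
   E is expected to consist of two-element subsets of V. *)
definition connected_components :: "nat set \<Rightarrow> edge set \<Rightarrow> nat set set" where
  "connected_components V E = (\<lambda>v. {w. (v, w) \<in> {(x, y). {x, y} \<in> E}\<^sup>*}) ` V"

(* The edges of the first m rounds in order of arrival: m independent uniform draws from the
   pairs of distinct vertices. Meaningful only for n \<ge> 2, since all_edges n is empty otherwise. *)
definition edge_process :: "nat \<Rightarrow> nat \<Rightarrow> edge list pmf" where
  "edge_process n m = replicate_pmf m (pmf_of_set (all_edges n))"

(* A deterministic rule that maps the coloured edges seen so far (oldest first) and the
   arriving edge to the colour of the latter. *)
type_synonym online_algorithm = "(edge \<times> nat) list \<Rightarrow> edge \<Rightarrow> nat"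

definition uses_colours :: "nat \<Rightarrow> online_algorithm \<Rightarrow> bool" where
  "uses_colours r A \<longleftrightarrow> (\<forall>h e. A h e < r)"

definition run_online :: "online_algorithm \<Rightarrow> edge list \<Rightarrow> (edge \<times> nat) list" where
  "run_online A es = fold (\<lambda>e h. h @ [(e, A h e)]) es []"

(* A pair of vertices that arrives repeatedly may belong to several colour classes. *)
definition colour_class :: "(edge \<times> nat) list \<Rightarrow> nat \<Rightarrow> edge set" where
  "colour_class h i = {e. (e, i) \<in> set h}"

lemma run_online_Nil [simp]: "run_online A [] = []"
  by (simp add: run_online_def)

lemma run_online_snoc [simp]:
  "run_online A (es @ [e]) = run_online A es @ [(e, A (run_online A es) e)]"
  by (simp add: run_online_def)

lemma map_fst_run_online [simp]: "map fst (run_online A es) = es"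
  by (induction es rule: rev_induct) simp_all

end

theory Submission
  imports Defs "HOL-Real_Asymp.Real_Asymp"
begin

text \<open>The algorithm ignores the history. Arrange the vertices in \<open>k\<close> columns, each vertex carrying one of
  \<open>q \<ge> sqrt r\<close> symbols, and reserve for colour \<open>i\<close> the pairs of vertices in different columns whose symbols
  lie on the \<open>i\<close>-th of the \<open>q\<^sup>2\<close> lines \<open>y = a x + b\<close> modulo \<open>q\<close>. If \<open>q\<close> is coprime to \<open>1, \<dots>, k - 1\<close>, no pair is
  reserved twice. The graph of a line has about \<open>n / q\<close> vertices and minimum degree about
  \<open>(1 - 1 / k) n / q\<close>, so after slightly more than \<open>q n / 2\<close> rounds its random subgraph is supercritical
  for large \<open>k\<close>.

  For the linear component, suppose that \<open>c n\<close> rounds have passed on a graph with \<open>\<alpha> n\<close> vertices and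
  minimum degree \<open>d n\<close>. If all components are small, then a union of about \<open>\<theta> n\<close> vertices is closed and
  spanned by a forest. Counting the possible forests by parent functions, the expected number of such
  configurations is about \<open>exp (\<theta> n (1 + ln (2 c \<alpha>) - 2 c d))\<close>, which tends to \<open>0\<close> if the exponent is
  negative.\<close>

section \<open>Edge-disjoint multipartite graphs from lines\<close>

text \<open>Vertex \<open>v\<close> lies in column \<open>v mod k\<close> and carries the symbol \<open>v div k mod q\<close>; line \<open>i < q\<^sup>2\<close> has slope
  \<open>i div q\<close> and intercept \<open>i mod q\<close>, and \<open>line_point k q i (x, z)\<close> is its \<open>z\<close>-th vertex in column \<open>x\<close>.\<close>
definition line_point :: "nat \<Rightarrow> nat \<Rightarrow> nat \<Rightarrow> nat \<times> nat \<Rightarrow> nat" where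
  "line_point k q i = (\<lambda>(x, z). k * (q * z + (i div q * x + i mod q) mod q) + x)"

definition line_vertices :: "nat \<Rightarrow> nat \<Rightarrow> nat \<Rightarrow> nat \<Rightarrow> nat set" where
  "line_vertices k q i n = {v. v < n \<and> v div k mod q = (i div q * (v mod k) + i mod q) mod q}"

definition line_edges :: "nat \<Rightarrow> nat \<Rightarrow> nat \<Rightarrow> nat \<Rightarrow> edge set" where
  "line_edges k q i n = {{u, v} |u v. u \<in> line_vertices k q i n \<and> v \<in> line_vertices k q i n
     \<and> u mod k \<noteq> v mod k}"

lemma line_point_mod [simp]: "x < k \<Longrightarrow> line_point k q i (x, z) mod k = x"
  by (simp add: line_point_def)

lemma line_point_div [simp]:
  "x < k \<Longrightarrow> line_point k q i (x, z) div k = q * z + (i div q * x + i mod q) mod q"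
  by (simp add: line_point_def)

lemma inj_on_line_point: "q > 0 \<Longrightarrow> inj_on (line_point k q i) ({..<k} \<times> UNIV)"
proof (rule inj_onI)
  fix p p' assume q: "q > 0" and p: "p \<in> {..<k} \<times> UNIV" "p' \<in> {..<k} \<times> UNIV"
    and eq: "line_point k q i p = line_point k q i p'"
  obtain x z x' z' where pp: "p = (x, z)" "p' = (x', z')" "x < k" "x' < k"
    using p by auto
  have "x = x'"
    using arg_cong[OF eq, of "\<lambda>v. v mod k"] pp by simp
  moreover have "z = z'"
    using arg_cong[OF eq, of "\<lambda>v. v div k div q"] pp q by simp
  ultimately show "p = p'"
    using pp by simp
qed

text \<open>Each complete block of \<open>k * q\<close> consecutive vertices contains one vertex of
  the line in every column. The incomplete last block is left out, since it may end before the
  required symbol.\<close>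

lemma line_point_in_line_vertices:
  assumes "x < k" "z < n div (k * q)" "q > 0"
  shows "line_point k q i (x, z) \<in> line_vertices k q i n"
proof -
  define y where "y = (i div q * x + i mod q) mod q"
  have y: "y < q"
    using assms by (simp add: y_def)
  have "line_point k q i (x, z) < k * (q * z + y + 1)"
    using assms by (simp add: line_point_def y_def)
  also have "\<dots> \<le> k * (q * (z + 1))"
    using y by (intro mult_left_mono) auto
  also have "\<dots> \<le> k * (q * (n div (k * q)))"
    using assms by (intro mult_left_mono) auto
  also have "\<dots> \<le> n"
    by (metis div_times_less_eq_dividend mult.assoc mult.commute)
  finally show ?thesis
    using assms by (simp add: line_vertices_def)
qed

lemma line_vertices_subset: "line_vertices k q i n \<subseteq> {..<n}"
  by (auto simp: line_vertices_def)

text \<open>The block of \<open>v\<close> has index \<open>v div (k * q)\<close>. The closed range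
  \<open>{..n div (k * q)}\<close> takes in the incomplete last block, which the lower bound on the
  size ignores.\<close>

lemma line_vertices_subset_image:
  assumes "k > 0"
  shows "line_vertices k q i n \<subseteq> line_point k q i ` ({..<k} \<times> {..n div (k * q)})"
proof
  fix v assume v: "v \<in> line_vertices k q i n"
  have eq: "v div k mod q = (i div q * (v mod k) + i mod q) mod q"
    using v unfolding line_vertices_def by blast
  have "v = line_point k q i (v mod k, v div (k * q))"
    unfolding line_point_def prod.case div_mult2_eq eq[symmetric] by simp
  moreover have "v div (k * q) \<le> n div (k * q)"
    using v by (intro div_le_mono) (simp add: line_vertices_def)
  ultimately show "v \<in> line_point k q i ` ({..<k} \<times> {..n div (k * q)})"
    using assms by (metis SigmaI atMost_iff imageI lessThan_iff mod_less_divisor)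
qed

lemma card_line_vertices_le:
  assumes "k > 0"
  shows "card (line_vertices k q i n) \<le> k * (n div (k * q) + 1)"
  using surj_card_le[OF _ line_vertices_subset_image[OF assms]] by simp

lemma card_line_vertices_ge:
  assumes "q > 0"
  shows "k * (n div (k * q)) \<le> card (line_vertices k q i n)"
proof -
  have "k * (n div (k * q)) = card (line_point k q i ` ({..<k} \<times> {..<n div (k * q)}))"
    using inj_on_line_point[OF assms, of k i] by (subst card_image) (auto elim: inj_on_subset)
  also have "\<dots> \<le> card (line_vertices k q i n)"
    using finite_subset[OF line_vertices_subset] assms
    by (intro card_mono) (auto intro: line_point_in_line_vertices)
  finally show ?thesis .
qed

lemma line_edges_subset: "line_edges k q i n \<subseteq> all_edges n" "line_edges k q i n \<subseteq> Pow (line_vertices k q i n)"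
  by (auto simp: line_edges_def all_edges_def line_vertices_def card_insert_if)

text \<open>Every point of the line in another column is a neighbour, and the complete blocks alone
  supply enough of them for the degree bound.\<close>

lemma line_point_image_subset_neighbours:
  assumes "q > 0" "v \<in> line_vertices k q i n"
  shows "line_point k q i ` (({..<k} - {v mod k}) \<times> {..<n div (k * q)})
    \<subseteq> {w \<in> line_vertices k q i n. {v, w} \<in> line_edges k q i n}"
proof (intro image_subsetI CollectI conjI)
  fix p assume p: "p \<in> ({..<k} - {v mod k}) \<times> {..<n div (k * q)}"
  obtain x z where xz: "p = (x, z)"
    by (rule prod.exhaust)
  have x: "x < k" "x \<noteq> v mod k" "z < n div (k * q)"
    using p unfolding xz by blast+
  show w: "line_point k q i p \<in> line_vertices k q i n"
    unfolding xz by (rule line_point_in_line_vertices[OF x(1,3) assms(1)])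
  have "v mod k \<noteq> line_point k q i p mod k"
    unfolding xz line_point_mod[OF x(1)] using x(2) by (rule not_sym)
  thus "{v, line_point k q i p} \<in> line_edges k q i n"
    unfolding line_edges_def using assms(2) w by blast
qed

lemma card_line_point_image:
  assumes "q > 0" "x < k"
  shows "card (line_point k q i ` (({..<k} - {x}) \<times> {..<t})) = (k - 1) * t"
proof -
  have "inj_on (line_point k q i) (({..<k} - {x}) \<times> {..<t})"
    by (rule inj_on_subset[OF inj_on_line_point[OF assms(1)]]) blast
  hence "card (line_point k q i ` (({..<k} - {x}) \<times> {..<t})) = card (({..<k} - {x}) \<times> {..<t})"
    by (rule card_image)
  also have "\<dots> = card ({..<k} - {x}) * t"
    by (simp only: card_cartesian_product card_lessThan)
  also have "card ({..<k} - {x}) = k - 1"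
    using assms(2) by (subst card_Diff_singleton) simp_all
  finally show ?thesis .
qed

text \<open>Two points in different columns determine a line. Subtracting the congruences at the two
  ends of \<open>e\<close> shows that \<open>q\<close> divides the difference of slopes times the
  difference of columns, and the latter is coprime to \<open>q\<close>.\<close>

lemma line_edges_unique:
  assumes cop: "\<And>t. 0 < t \<Longrightarrow> t < k \<Longrightarrow> coprime t q" and k: "k > 0"
    and i: "i < q\<^sup>2" "i' < q\<^sup>2" and e: "e \<in> line_edges k q i n" "e \<in> line_edges k q i' n"
  shows "i = i'"
proof -
  have q: "q > 0"
    using i by (cases q) auto
  obtain u v where uv: "e = {u, v}" "u mod k \<noteq> v mod k"
    using e(1) by (auto simp: line_edges_def)
  have L: "u \<in> line_vertices k q i n" "v \<in> line_vertices k q i n"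
     "u \<in> line_vertices k q i' n" "v \<in> line_vertices k q i' n"
    using e line_edges_subset(2) uv by blast+
  define a b where "a = int (i div q) - int (i' div q)" and "b = int (i mod q) - int (i' mod q)"
  have dvd: "int q dvd a * int (w mod k) + b"
    if "w \<in> line_vertices k q i n" "w \<in> line_vertices k q i' n" for w
  proof -
    have "(i div q * (w mod k) + i mod q) mod q = (i' div q * (w mod k) + i' mod q) mod q"
      using that by (simp add: line_vertices_def)
    hence "int (i div q * (w mod k) + i mod q) mod int q = int (i' div q * (w mod k) + i' mod q) mod int q"
      by (metis zmod_int)
    hence "int q dvd int (i div q * (w mod k) + i mod q) - int (i' div q * (w mod k) + i' mod q)"
      by (simp add: mod_eq_dvd_iff)
    also have "\<dots> = a * int (w mod k) + b"
      by (simp add: a_def b_def algebra_simps)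
    finally show ?thesis .
  qed
  define t where "t = int (u mod k) - int (v mod k)"
  have "int q dvd (a * int (u mod k) + b) - (a * int (v mod k) + b)"
    using dvd L by (intro dvd_diff)
  hence "int q dvd a * t"
    by (simp add: t_def algebra_simps)
  moreover have "coprime (int q) t"
  proof -
    have "u mod k < k" "v mod k < k"
      using k by auto
    hence "\<bar>t\<bar> < int k"
      unfolding t_def by linarith
    hence "nat \<bar>t\<bar> < k"
      by linarith
    moreover have "0 < nat \<bar>t\<bar>"
      using uv(2) by (simp add: t_def)
    ultimately have "coprime (int (nat \<bar>t\<bar>)) (int q)"
      using cop by (simp only: coprime_int_iff)
    thus ?thesis
      by (simp add: coprime_commute)
  qed
  ultimately have qa: "int q dvd a"
    by (simp add: coprime_dvd_mult_left_iff)
  \<comment> \<open>Both slopes lie below \<open>q\<close>, so a difference divisible by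
    \<open>q\<close> vanishes. The same argument then applies to the intercepts.\<close>
  have "i div q < q" "i' div q < q"
    using i by (auto simp: less_mult_imp_div_less power2_eq_square)
  hence "\<bar>a\<bar> < int q"
    by (auto simp: a_def)
  hence a0: "a = 0"
    using qa dvd_imp_le_int[of a "int q"] by (cases "a = 0") auto
  hence "int q dvd b"
    using dvd[OF L(1,3)] by simp
  moreover have "i mod q < q" "i' mod q < q"
    using q by auto
  hence "\<bar>b\<bar> < int q"
    unfolding b_def by linarith
  ultimately have "b = 0"
    using dvd_imp_le_int[of b "int q"] by (cases "b = 0") auto
  hence "i div q = i' div q" "i mod q = i' mod q"
    using a0 by (auto simp: a_def b_def)
  thus ?thesis
    by (metis div_mult_mod_eq)
qed

section \<open>Probability of hitting and avoiding sets of edges\<close>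

text \<open>Heuristically, the elements of \<open>F\<close> are assigned to distinct rounds, each
  assignment costs a factor \<open>1 / card X\<close>, and all other rounds must avoid
  \<open>A\<close>. The induction conditions on the first round: an edge of \<open>A\<close> is
  fatal, an edge of \<open>F\<close> is struck off \<open>F\<close>, any other edge leaves
  \<open>F\<close> unchanged.\<close>

lemma prob_hit_avoid:
  assumes X: "finite X" "X \<noteq> {}" and A: "A \<subseteq> X" and F: "finite F"
  shows "measure_pmf.prob (replicate_pmf m (pmf_of_set X)) {es. F \<subseteq> set es \<and> set es \<inter> A = {}}
    \<le> real (m choose card F) * fact (card F) / real (card X) ^ card F
       * (1 - real (card A) / real (card X)) ^ (m - card F)"
  using F
proof (induction m arbitrary: F)
  case 0
  show ?case
    by (cases "F = {}") (use 0 in \<open>auto simp: card_gt_0_iff binomial_eq_0 measure_return\<close>)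
next
  case (Suc m)
  define M where "M = real (card X)"
  define p where "p = 1 - real (card A) / M"
  define b where "b = (\<lambda>t. real (m choose t) * fact t / M ^ t * p ^ (m - t))"
  define P where "P = (\<lambda>F. measure_pmf.prob (replicate_pmf m (pmf_of_set X))
      {es. F \<subseteq> set es \<and> set es \<inter> A = {}})"
  have M: "M > 0"
    using X by (simp add: M_def card_gt_0_iff)
  have cA: "card A \<le> card X" "finite A"
    using A X by (auto intro: card_mono finite_subset)
  have p: "p \<ge> 0" "real (card (X - A)) / M = p"
    using cA M X A by (auto simp: p_def M_def field_simps card_Diff_subset of_nat_diff)
  have b0: "b t \<ge> 0" for t
    using M p by (simp add: b_def)
  have IH: "P G \<le> b (card G)" if "finite G" for G
    using Suc.IH[OF that] by (simp add: P_def b_def M_def p_def)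
  have "measure_pmf.prob (replicate_pmf (Suc m) (pmf_of_set X)) {es. F \<subseteq> set es \<and> set es \<inter> A = {}}
     = measure_pmf.expectation (pmf_of_set X)
         (\<lambda>e. measure_pmf.prob (map_pmf ((#) e) (replicate_pmf m (pmf_of_set X)))
            {es. F \<subseteq> set es \<and> set es \<inter> A = {}})"
    by (simp add: measure_pmf_bind map_pmf_def[symmetric] 
        measure_pmf.measure_bind[where N = "count_space UNIV"] del: measure_map_pmf)
       (subst measure_pmf.measure_bind[where N = "count_space UNIV"], simp_all add: measure_pmf_in_subprob_space)
  also have "\<dots> = (\<Sum>e\<in>X. if e \<in> A then 0 else P (F - {e})) / M"
  proof -
    have "measure_pmf.prob (map_pmf ((#) e) (replicate_pmf m (pmf_of_set X)))
            {es. F \<subseteq> set es \<and> set es \<inter> A = {}} = (if e \<in> A then 0 else P (F - {e}))" for e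
    proof -
      have "(#) e -` {es. F \<subseteq> set es \<and> set es \<inter> A = {}}
        = (if e \<in> A then {} else {es. F - {e} \<subseteq> set es \<and> set es \<inter> A = {}})"
        by auto
      thus ?thesis by (simp add: P_def)
    qed
    thus ?thesis using X by (simp add: integral_pmf_of_set M_def)
  qed
  also have "(\<Sum>e\<in>X. if e \<in> A then 0 else P (F - {e})) = (\<Sum>e\<in>X - A. P (F - {e}))"
    using X by (simp add: sum.If_cases Diff_eq)
  also have "\<dots> = (\<Sum>e\<in>(X - A) \<inter> F. P (F - {e})) + (\<Sum>e\<in>(X - A) - F. P (F - {e}))"
    using X by (metis finite_Diff sum.Int_Diff)
  also have "(\<Sum>e\<in>(X - A) \<inter> F. P (F - {e})) \<le> (\<Sum>e\<in>(X - A) \<inter> F. b (card F - 1))"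
    by (rule sum_mono) (use IH Suc.prems in \<open>metis Diff_iff IntD2 card_Diff_singleton finite_Diff\<close>)
  also have "\<dots> \<le> real (card F) * b (card F - 1)"
    using b0 Suc.prems by (auto intro!: mult_right_mono card_mono)
  also have "(\<Sum>e\<in>(X - A) - F. P (F - {e})) \<le> (\<Sum>e\<in>(X - A) - F. b (card F))"
    by (rule sum_mono) (use IH Suc.prems in auto)
  also have "\<dots> \<le> real (card (X - A)) * b (card F)"
    using b0 X by (auto intro!: mult_right_mono card_mono)
  \<comment> \<open>For nonempty \<open>F\<close> this is Pascal's rule for the binomial
    coefficients.\<close>
  also have "(real (card F) * b (card F - 1) + real (card (X - A)) * b (card F)) / M
      = real (Suc m choose card F) * fact (card F) / M ^ card F * p ^ (Suc m - card F)"
  proof (cases "card F")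
    case 0
    thus ?thesis using p M by (simp add: b_def field_simps)
  next
    case (Suc t)
    have "real (card (X - A)) * b (Suc t) / M = p * b (Suc t)"
      using p(2) by (metis mult.commute times_divide_eq_right)
    also have "\<dots> = real (m choose Suc t) * fact (Suc t) / M ^ Suc t * p ^ (m - t)"
    \<comment> \<open>For \<open>m < Suc t\<close> the truncated exponents do not differ by one, but
      the binomial coefficient is zero.\<close>
    proof (cases "Suc t \<le> m")
      case True
      hence "m - t = Suc (m - Suc t)" by simp
      thus ?thesis by (simp add: b_def)
    qed (simp add: b_def binomial_eq_0)
    finally show ?thesis
      using M by (simp add: Suc add_divide_distrib) (simp add: b_def field_simps)
  qed
  finally show ?case
    by (simp add: M_def p_def divide_right_mono)
qed

section \<open>Absence of large components\<close>

definition adj :: "edge set \<Rightarrow> (nat \<times> nat) set" where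
  "adj G = {(x, y). {x, y} \<in> G}"

text \<open>Here \<open>d\<close> is the distance from \<open>X\<close> and \<open>f\<close> picks a
  predecessor on a shortest path. The strict decrease of \<open>d\<close> will make the parent edges
  distinct.\<close>

lemma reach_parent:
  fixes R :: "('a \<times> 'a) set"
  obtains f :: "'a \<Rightarrow> 'a" and d :: "'a \<Rightarrow> nat"
  where "\<And>v. v \<in> R\<^sup>* `` X - X \<Longrightarrow> f v \<in> R\<^sup>* `` X \<and> (f v, v) \<in> R \<and> d (f v) < d v"
proof -
  define d where "d = (\<lambda>v. LEAST k. v \<in> (R ^^ k) `` X)"
  have "\<exists>u. u \<in> R\<^sup>* `` X \<and> (u, v) \<in> R \<and> d u < d v" if v: "v \<in> R\<^sup>* `` X - X" for v
  proof -
    have "\<exists>k. v \<in> (R ^^ k) `` X"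
      using v rtrancl_imp_relpow by (force simp: Image_iff)
    hence dv: "v \<in> (R ^^ d v) `` X"
      unfolding d_def by (rule LeastI_ex)
    moreover have "d v \<noteq> 0"
      using dv v by (intro notI) auto
    ultimately obtain j x where j: "d v = Suc j" and x: "x \<in> X" "(x, v) \<in> R ^^ Suc j"
      by (cases "d v") auto
    then obtain u where u: "(x, u) \<in> R ^^ j" "(u, v) \<in> R"
      by auto
    have "d u \<le> j"
      unfolding d_def using u x by (intro Least_le) auto
    moreover have "u \<in> R\<^sup>* `` X"
      using u x relpow_imp_rtrancl by blast
    ultimately show ?thesis
      using u j by auto
  qed
  then obtain f where "\<And>v. v \<in> R\<^sup>* `` X - X \<Longrightarrow> f v \<in> R\<^sup>* `` X \<and> (f v, v) \<in> R \<and> d (f v) < d v"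
    by metis
  thus ?thesis by (rule that)
qed

text \<open>Discrete continuity: start vertices are added one at a time, each enlarging the reach by
  at most \<open>k\<close>, so the first reach of size at least \<open>J\<close> overshoots by at
  most \<open>k\<close>.\<close>

lemma exists_reach_of_size:
  fixes V :: "nat set" and R :: "(nat \<times> nat) set"
  assumes V: "V \<subseteq> {..<n}" and R: "R \<subseteq> V \<times> V" and J: "J \<le> card V"
    and small: "\<And>v. v \<in> V \<Longrightarrow> card (R\<^sup>* `` {v}) \<le> k"
  obtains a where "a \<le> n" "J \<le> card (R\<^sup>* `` (V \<inter> {..<a}))" "card (R\<^sup>* `` (V \<inter> {..<a})) \<le> J + k"
proof -
  define S where "S = (\<lambda>a. R\<^sup>* `` (V \<inter> {..<a}))"
  have closed: "R\<^sup>* `` V = V"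
    using R by (intro equalityI subsetI) (auto elim: rtranclE)
  hence S_V: "S a \<subseteq> V" for a
    unfolding S_def using Image_mono[of "R\<^sup>*" "R\<^sup>*" "V \<inter> {..<a}" V] by auto
  have fV: "finite V"
    using V finite_subset by blast
  have "S n = V"
    using V closed by (simp add: S_def Int_absorb2)
  hence Jn: "J \<le> card (S n)"
    using J by simp
  define a where "a = (LEAST a. J \<le> card (S a))"
  have a: "J \<le> card (S a)" "a \<le> n"
    unfolding a_def using Jn by (auto intro: LeastI Least_le)
  have "card (S a) \<le> J + k"
  proof (cases a)
    case 0
    thus ?thesis by (simp add: S_def)
  next
    case (Suc b)
    have "card (S b) < J"
      using not_less_Least[of b "\<lambda>a. J \<le> card (S a)"] Suc by (simp add: a_def)
    moreover have "card (S a) \<le> card (S b) + k"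
    proof (cases "b \<in> V")
      case True
      have "S a = S b \<union> R\<^sup>* `` {b}"
        using True by (auto simp: S_def Suc lessThan_Suc)
      thus ?thesis
        using card_Un_le[of "S b" "R\<^sup>* `` {b}"] small[OF True] by simp
    next
      case False
      hence "S a = S b" by (auto simp: S_def Suc lessThan_Suc)
      thus ?thesis by simp
    qed
    ultimately show ?thesis by simp
  qed
  thus ?thesis using a that by (auto simp: S_def)
qed

definition boundary :: "edge set \<Rightarrow> nat set \<Rightarrow> edge set" where
  "boundary H S = {e \<in> H. \<exists>v\<in>S. \<exists>w. w \<notin> S \<and> e = {v, w}}"

text \<open>At most \<open>card S\<close> neighbours of a vertex lie in \<open>S\<close>, so the
  others lie outside. No edge is counted twice, because exactly one of its ends is in
  \<open>S\<close>.\<close>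

lemma card_boundary_ge:
  assumes H: "finite H" and V: "finite V" "S \<subseteq> V"
    and deg: "\<And>v. v \<in> S \<Longrightarrow> D \<le> card {w \<in> V. {v, w} \<in> H}"
  shows "card S * (D - card S) \<le> card (boundary H S)"
proof -
  have fS: "finite S"
    using V finite_subset by blast
  let ?T = "SIGMA v:S. {w \<in> V - S. {v, w} \<in> H}"
  have "card S * (D - card S) = (\<Sum>v\<in>S. D - card S)"
    by simp
  also have "\<dots> \<le> (\<Sum>v\<in>S. card {w \<in> V - S. {v, w} \<in> H})"
  proof (rule sum_mono)
    fix v assume v: "v \<in> S"
    have "D \<le> card {w \<in> V. {v, w} \<in> H}"
      using deg v by blast
    also have "\<dots> \<le> card ({w \<in> V - S. {v, w} \<in> H} \<union> S)"
      using V fS by (intro card_mono) auto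
    also have "\<dots> \<le> card {w \<in> V - S. {v, w} \<in> H} + card S"
      by (rule card_Un_le)
    finally show "D - card S \<le> card {w \<in> V - S. {v, w} \<in> H}" by simp
  qed
  also have "\<dots> = card ?T"
    using V fS by (simp add: card_SigmaI)
  also have "\<dots> = card ((\<lambda>(v, w). {v, w}) ` ?T)"
    by (intro card_image[symmetric] inj_onI) (auto simp: doubleton_eq_iff)
  also have "\<dots> \<le> card (boundary H S)"
    using H by (intro card_mono) (auto simp: boundary_def)
  finally show ?thesis .
qed

lemma power_one_minus_le_exp:
  fixes x :: real
  assumes "x \<le> 1"
  shows "(1 - x) ^ k \<le> exp (- x * real k)"
proof -
  have "(1 - x) ^ k \<le> exp (- x) ^ k"
    using assms exp_ge_add_one_self[of "- x"] by (intro power_mono) auto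
  thus ?thesis by (simp add: exp_of_nat_mult[symmetric] mult.commute)
qed

lemma sum_Pow_power_card:
  fixes y :: real
  assumes "finite V"
  shows "(\<Sum>R\<in>Pow V. y ^ card R) = (1 + y) ^ card V"
  using prod_add[OF assms, of "\<lambda>_. y" "\<lambda>_. 1"] by (simp add: add.commute)

lemma finite_all_edges [simp]: "finite (all_edges n)"
  by (rule finite_subset[of _ "Pow {..<n}"]) (auto simp: all_edges_def)

lemma card_all_edges: "card (all_edges n) = n choose 2"
  using n_subsets[of "{..<n}" 2] by (simp add: all_edges_def)

text \<open>If all components are small, some initial segment of \<open>V\<close> has a reach \<open>S\<close> with between \<open>J\<close> and
  \<open>B\<close> elements. Then no edge leaves \<open>S\<close>, and a parent function on the set \<open>R\<close> of points outside the
  segment gives \<open>card R\<close> distinct edges. Since \<open>S\<close> is determined by \<open>R\<close> and the end of the segment, the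
  union bound has only \<open>n + 1\<close> choices for \<open>S\<close> besides those for \<open>R\<close>.\<close>
lemma prob_no_large_component:
  fixes V :: "nat set" and H :: "edge set" and n m J k D :: nat and z :: real
  defines "M \<equiv> real (card (all_edges n))" and "B \<equiv> J + k"
  assumes n: "n \<ge> 2" and V: "V \<subseteq> {..<n}" and H: "H \<subseteq> all_edges n" "H \<subseteq> Pow V"
    and deg: "\<And>v. v \<in> V \<Longrightarrow> D \<le> card {w \<in> V. {v, w} \<in> H}"
    and J: "J \<le> card V" and BD: "B \<le> D" and Bm: "B \<le> m" and z: "0 < z" "z \<le> 1"
  shows "measure_pmf.prob (edge_process n m)
      {es. \<forall>v\<in>V. card ((adj (set es \<inter> H))\<^sup>* `` {v}) \<le> k}
    \<le> (real n + 1) * ((1 / z) ^ B * exp (z * B * m / M * card V)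
         * exp (- (real J * (real D - B) / M * (real m - B))))"
proof -
  let ?P = "measure_pmf.prob (edge_process n m)"
  define X where "X = exp (- (real J * (real D - B) / M * (real m - B)))"
  \<comment> \<open>\<open>S a R\<close> recovers the closed set from its roots, the points of
    \<open>V\<close> below \<open>a\<close>, and the remaining points \<open>R\<close>.
    \<open>\<Phi>\<close> collects the candidate parent functions, and \<open>E\<close> is the event
    that the parent edges have arrived and no edge leaves the set.\<close>
  define S where "S = (\<lambda>a R. R \<union> (V \<inter> {..<a}))"
  define \<R> where "\<R> = (\<lambda>a. {R \<in> Pow V. card R \<le> B \<and> J \<le> card (S a R) \<and> card (S a R) \<le> B})"
  define \<Phi> where "\<Phi> = (\<lambda>a R. {f \<in> R \<rightarrow>\<^sub>E S a R. inj_on (\<lambda>v. {v, f v}) R})"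
  define E where "E = (\<lambda>a R f. {es. (\<lambda>v. {v, f v}) ` R \<subseteq> set es \<and> set es \<inter> boundary H (S a R) = {}})"
  have fV: "finite V"
    using finite_subset[OF V] by simp
  have fH: "finite H"
    using finite_subset[OF H(1)] by simp
  have M: "M > 0"
    using n by (simp add: M_def card_all_edges)
  hence ne: "all_edges n \<noteq> {}"
    by (auto simp: M_def)
  have fS: "finite (S a R)" "S a R \<subseteq> V" if "R \<subseteq> V" for a R
    using that fV finite_subset by (auto simp: S_def)
  have f\<R>: "finite (\<R> a)" for a
    using fV by (simp add: \<R>_def)

  have E_le: "?P (E a R f) \<le> (m / M) ^ card R * X" if R: "R \<in> \<R> a" and f: "f \<in> \<Phi> a R" for a R f
  proof (cases "card R \<le> m")
    case True
    let ?A = "boundary H (S a R)"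
    have RV: "R \<subseteq> V"
      using R by (simp add: \<R>_def)
    have A: "?A \<subseteq> all_edges n"
      using H by (auto simp: boundary_def)
    have AM: "real (card ?A) / M \<le> 1"
      using A M by (auto simp: M_def card_mono)
    \<comment> \<open>The size of \<open>S a R\<close> lies between \<open>J\<close> and
      \<open>B\<close>, so each factor of the boundary bound is estimated by its own worst
      case.\<close>
    have "J * (D - B) \<le> card (S a R) * (D - card (S a R))"
      using R by (intro mult_le_mono) (auto simp: \<R>_def)
    also have "\<dots> \<le> card ?A"
      using fS[OF RV] deg by (intro card_boundary_ge[OF fH fV]) auto
    finally have "real (J * (D - B)) \<le> real (card ?A)"
      using of_nat_le_iff by blast
    hence JA: "real J * (real D - B) \<le> real (card ?A)"
      using BD by (simp add: of_nat_diff)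
    have "?P (E a R f) \<le> real (m choose card R) * fact (card R) / M ^ card R
            * (1 - real (card ?A) / M) ^ (m - card R)"
    proof -
      have "card ((\<lambda>v. {v, f v}) ` R) = card R"
        using f by (simp add: \<Phi>_def card_image)
      thus ?thesis
        using prob_hit_avoid[OF finite_all_edges ne A, of "(\<lambda>v. {v, f v}) ` R" m] RV fV finite_subset
        by (auto simp: E_def edge_process_def M_def)
    qed
    also have "\<dots> \<le> real m ^ card R / M ^ card R * exp (- (real (card ?A) / M) * real (m - card R))"
    proof (intro mult_mono divide_right_mono power_one_minus_le_exp AM)
      have "real ((m choose card R) * fact (card R)) \<le> real (m ^ card R)"
        using binomial_fact_pow of_nat_le_iff by blast
      thus "real (m choose card R) * fact (card R) \<le> real m ^ card R"
        by simp
    qed (use M AM in auto)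
    also have "\<dots> \<le> real m ^ card R / M ^ card R * X"
    proof (rule mult_left_mono)
      have "real J * (real D - B) / M * (real m - B) \<le> real (card ?A) / M * real (m - card R)"
        using R JA Bm BD M True by (intro mult_mono divide_right_mono) (auto simp: \<R>_def of_nat_diff)
      thus "exp (- (real (card ?A) / M) * real (m - card R)) \<le> X"
        by (simp add: X_def)
    qed (use M in auto)
    finally show ?thesis by (simp add: power_divide)
  next
    case False
    \<comment> \<open>The parent edges are distinct, so they cannot all arrive in fewer than
      \<open>card R\<close> rounds.\<close>
    have "E a R f \<inter> set_pmf (edge_process n m) = {}"
    proof -
      have "False" if "(\<lambda>v. {v, f v}) ` R \<subseteq> set es" "length es = m" for es
      proof -
        have "card R = card ((\<lambda>v. {v, f v}) ` R)"
          using f by (simp add: \<Phi>_def card_image)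
        also have "\<dots> \<le> length es"
          using that by (meson List.finite_set card_length card_mono order_trans)
        finally show False using that False by simp
      qed
      thus ?thesis by (auto simp: E_def edge_process_def set_replicate_pmf)
    qed
    hence "?P (E a R f) = 0"
      by (simp add: measure_pmf_zero_iff Int_commute)
    thus ?thesis using M by (simp add: X_def)
  qed

  have R_le: "?P (\<Union>f\<in>\<Phi> a R. E a R f) \<le> (B * m / M) ^ card R * X" if R: "R \<in> \<R> a" for a R
  proof -
    have RV: "R \<subseteq> V" "finite R"
      using R fV finite_subset by (auto simp: \<R>_def)
    have fPi: "finite (R \<rightarrow>\<^sub>E S a R)"
      using RV fS by (intro finite_PiE) auto
    have f\<Phi>: "finite (\<Phi> a R)"
      using fPi by (simp add: \<Phi>_def)
    have "card (\<Phi> a R) \<le> card (R \<rightarrow>\<^sub>E S a R)"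
      using fPi by (intro card_mono) (auto simp: \<Phi>_def)
    also have "\<dots> = card (S a R) ^ card R"
      using RV by (simp add: card_PiE)
    also have "\<dots> \<le> B ^ card R"
      using R by (intro power_mono) (auto simp: \<R>_def)
    finally have c\<Phi>: "real (card (\<Phi> a R)) \<le> real B ^ card R"
      by (metis of_nat_le_iff of_nat_power)
    have "?P (\<Union>f\<in>\<Phi> a R. E a R f) \<le> (\<Sum>f\<in>\<Phi> a R. ?P (E a R f))"
      using f\<Phi> by (intro measure_UNION_le) auto
    also have "\<dots> \<le> (\<Sum>f\<in>\<Phi> a R. (m / M) ^ card R * X)"
      using E_le[OF R] by (rule sum_mono)
    also have "\<dots> = real (card (\<Phi> a R)) * ((m / M) ^ card R * X)"
      by simp
    also have "\<dots> \<le> real B ^ card R * ((m / M) ^ card R * X)"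
      using M by (intro mult_right_mono c\<Phi>) (auto simp: X_def)
    finally have "?P (\<Union>f\<in>\<Phi> a R. E a R f) \<le> real B ^ card R * ((m / M) ^ card R * X)" .
    thus ?thesis by (simp add: power_mult_distrib power_divide)
  qed

  \<comment> \<open>The weights \<open>z ^ card R / z ^ B \<ge> 1\<close> turn the sum over \<open>R\<close> into a binomial expansion.\<close>
  have a_le: "?P (\<Union>R\<in>\<R> a. \<Union>f\<in>\<Phi> a R. E a R f)
      \<le> (1 / z) ^ B * exp (z * B * m / M * card V) * X" for a
  proof -
    have "?P (\<Union>R\<in>\<R> a. \<Union>f\<in>\<Phi> a R. E a R f) \<le> (\<Sum>R\<in>\<R> a. ?P (\<Union>f\<in>\<Phi> a R. E a R f))"
      by (intro measure_UNION_le f\<R>) auto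
    also have "\<dots> \<le> (\<Sum>R\<in>\<R> a. (1 / z) ^ B * X * (z * B * m / M) ^ card R)"
    proof (rule sum_mono)
      fix R assume R: "R \<in> \<R> a"
      have "1 = (1 / z) ^ card R * z ^ card R"
        using z by (simp add: power_divide)
      also have "\<dots> \<le> (1 / z) ^ B * z ^ card R"
        using z R by (intro mult_right_mono power_increasing) (auto simp: \<R>_def)
      finally have "1 * ((B * m / M) ^ card R * X) \<le> (1 / z) ^ B * z ^ card R * ((B * m / M) ^ card R * X)"
        using M by (intro mult_right_mono) (auto simp: X_def)
      thus "?P (\<Union>f\<in>\<Phi> a R. E a R f) \<le> (1 / z) ^ B * X * (z * B * m / M) ^ card R"
        using R_le[OF R] by (simp add: power_mult_distrib power_divide mult_ac)
    qed
    also have "\<dots> \<le> (\<Sum>R\<in>Pow V. (1 / z) ^ B * X * (z * B * m / M) ^ card R)"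
      using fV z M by (intro sum_mono2) (auto simp: \<R>_def X_def)
    also have "\<dots> = (1 / z) ^ B * X * (1 + z * B * m / M) ^ card V"
      using sum_Pow_power_card[OF fV, of "z * B * m / M"] by (simp add: sum_distrib_left[symmetric])
    also have "\<dots> \<le> (1 / z) ^ B * X * exp (z * B * m / M * card V)"
    proof (rule mult_left_mono)
      have "(1 + z * B * m / M) ^ card V \<le> exp (z * B * m / M) ^ card V"
        using z M by (intro power_mono) auto
      thus "(1 + z * B * m / M) ^ card V \<le> exp (z * B * m / M * card V)"
        by (simp only: exp_of_nat2_mult)
    qed (use z in \<open>auto simp: X_def\<close>)
    finally show ?thesis by (simp add: mult_ac)
  qed

  have cover: "{es. \<forall>v\<in>V. card ((adj (set es \<inter> H))\<^sup>* `` {v}) \<le> k}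
      \<subseteq> (\<Union>a\<in>{..n}. \<Union>R\<in>\<R> a. \<Union>f\<in>\<Phi> a R. E a R f)"
  proof
    fix es assume es: "es \<in> {es. \<forall>v\<in>V. card ((adj (set es \<inter> H))\<^sup>* `` {v}) \<le> k}"
    define Q where "Q = adj (set es \<inter> H)"
    have QV: "Q \<subseteq> V \<times> V"
      using H by (auto simp: Q_def adj_def)
    obtain a where a: "a \<le> n" "J \<le> card (Q\<^sup>* `` (V \<inter> {..<a}))" "card (Q\<^sup>* `` (V \<inter> {..<a})) \<le> B"
      using exists_reach_of_size[OF V QV J, of k] es by (auto simp: Q_def B_def)
    define W where "W = Q\<^sup>* `` (V \<inter> {..<a})"
    \<comment> \<open>The points of the segment serve as roots of the forest; only the others need a
      parent.\<close>
    define R where "R = W - V \<inter> {..<a}"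
    have XW: "V \<inter> {..<a} \<subseteq> W"
      by (auto simp: W_def)
    have WV: "W \<subseteq> V"
    proof
      fix w assume "w \<in> W"
      then obtain x where "x \<in> V" "(x, w) \<in> Q\<^sup>*"
        by (auto simp: W_def)
      thus "w \<in> V"
        using QV by (auto elim: rtranclE)
    qed
    have SW: "S a R = W"
      using XW by (auto simp: S_def R_def)
    have "card R \<le> card W"
      using WV fV finite_subset by (intro card_mono) (auto simp: R_def)
    hence R: "R \<in> \<R> a"
      using a WV SW by (auto simp: \<R>_def R_def W_def)
    obtain g d where g: "\<And>v. v \<in> R \<Longrightarrow> g v \<in> W \<and> (g v, v) \<in> Q \<and> d (g v) < (d v :: nat)"
      using reach_parent[of Q "V \<inter> {..<a}"] unfolding W_def R_def by metis
    define f where "f = restrict g R"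
    have f: "f \<in> \<Phi> a R"
      unfolding \<Phi>_def
    proof (intro CollectI conjI)
      show "f \<in> R \<rightarrow>\<^sub>E S a R"
        using g SW by (auto simp: f_def)
      show "inj_on (\<lambda>v. {v, f v}) R"
      proof (rule inj_onI)
        \<comment> \<open>If different vertices had the same parent edge, each would be the parent
          of the other, contradicting the decrease of \<open>d\<close>.\<close>
        fix v w assume vw: "v \<in> R" "w \<in> R" "{v, f v} = {w, f w}"
        hence "v = w \<or> (v = g w \<and> w = g v)"
          by (auto simp: f_def doubleton_eq_iff)
        thus "v = w"
          using g[OF vw(1)] g[OF vw(2)] by auto
      qed
    qed
    have "es \<in> E a R f"
      unfolding E_def
    proof (intro CollectI conjI)
      show "(\<lambda>v. {v, f v}) ` R \<subseteq> set es"
        using g by (auto simp: f_def Q_def adj_def insert_commute)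
      have False if "e \<in> set es" "e \<in> H" "e = {v, w}" "v \<in> W" "w \<notin> W" for e v w
      proof -
        have "(v, w) \<in> Q"
          using that by (simp add: Q_def adj_def)
        thus False
          using that by (auto simp: W_def intro: rtrancl.rtrancl_into_rtrancl)
      qed
      thus "set es \<inter> boundary H (S a R) = {}"
        unfolding SW boundary_def by blast
    qed
    thus "es \<in> (\<Union>a\<in>{..n}. \<Union>R\<in>\<R> a. \<Union>f\<in>\<Phi> a R. E a R f)"
      using a(1) R f by auto
  qed
  have "?P {es. \<forall>v\<in>V. card ((adj (set es \<inter> H))\<^sup>* `` {v}) \<le> k}
      \<le> ?P (\<Union>a\<in>{..n}. \<Union>R\<in>\<R> a. \<Union>f\<in>\<Phi> a R. E a R f)"
    using cover by (intro measure_pmf.finite_measure_mono) auto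
  also have "\<dots> \<le> (\<Sum>a\<in>{..n}. ?P (\<Union>R\<in>\<R> a. \<Union>f\<in>\<Phi> a R. E a R f))"
    by (intro measure_UNION_le) auto
  also have "\<dots> \<le> (\<Sum>a\<in>{..n}. (1 / z) ^ B * exp (z * B * m / M * card V) * X)"
    by (intro sum_mono a_le)
  also have "\<dots> = (real n + 1) * ((1 / z) ^ B * exp (z * B * m / M * card V) * X)"
    by simp
  finally show ?thesis
    by (simp add: X_def)
qed

section \<open>Large components above the threshold\<close>

lemma tendsto_ceiling_div:
  "(\<lambda>n. real (nat \<lceil>x * real n\<rceil>) / real n) \<longlonglongrightarrow> x" if "x \<ge> 0" for x :: real
proof (rule tendsto_sandwich)
  show "\<forall>\<^sub>F n in sequentially. x \<le> real (nat \<lceil>x * real n\<rceil>) / real n"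
    using eventually_gt_at_top[of 0] by eventually_elim (auto simp: field_simps intro: of_nat_ceiling)
  show "\<forall>\<^sub>F n in sequentially. real (nat \<lceil>x * real n\<rceil>) / real n \<le> x + 1 / real n"
    using eventually_gt_at_top[of 0]
  proof eventually_elim
    case (elim n)
    have "real (nat \<lceil>x * real n\<rceil>) \<le> x * real n + 1"
      using that of_int_ceiling_le_add_one[of "x * real n"] by (simp add: ceiling_le_zero)
    thus ?case using elim by (simp add: field_simps)
  qed
  show "(\<lambda>n. x + 1 / real n) \<longlonglongrightarrow> x"
    using tendsto_add[OF tendsto_const[of x] lim_1_over_n] by simp
qed auto

lemma tendsto_floor_div:
  "(\<lambda>n. real (nat \<lfloor>x * real n\<rfloor>) / real n) \<longlonglongrightarrow> x" if "x \<ge> 0" for x :: real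
proof (rule tendsto_sandwich)
  show "\<forall>\<^sub>F n in sequentially. x - 1 / real n \<le> real (nat \<lfloor>x * real n\<rfloor>) / real n"
    using eventually_gt_at_top[of 0]
  proof eventually_elim
    case (elim n)
    have "x * real n - 1 \<le> real (nat \<lfloor>x * real n\<rfloor>)"
      using that by linarith
    hence "(x * real n - 1) / real n \<le> real (nat \<lfloor>x * real n\<rfloor>) / real n"
      by (rule divide_right_mono) simp
    thus ?case using elim by (simp add: diff_divide_distrib)
  qed
  show "\<forall>\<^sub>F n in sequentially. real (nat \<lfloor>x * real n\<rfloor>) / real n \<le> x"
    using eventually_gt_at_top[of 0]
  proof eventually_elim
    case (elim n)
    have "real (nat \<lfloor>x * real n\<rfloor>) \<le> x * real n"
      using that by simp
    thus ?case using elim by (simp add: field_simps)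
  qed
  show "(\<lambda>n. x - 1 / real n) \<longlonglongrightarrow> x"
    using tendsto_diff[OF tendsto_const[of x] lim_1_over_n] by simp
qed auto

lemma tendsto_linear_times_exp_neg:
  fixes \<gamma> :: real
  assumes "\<gamma> > 0"
  shows "(\<lambda>n. (real n + 1) * exp (- \<gamma> * real n)) \<longlonglongrightarrow> 0"
  using assms by real_asymp

text \<open>The previous bound is applied with \<open>J\<close> about \<open>\<theta> n\<close>,
  \<open>k\<close> about \<open>\<theta>\<^sup>2 n\<close> and weight \<open>z = 1 / x\<close>,
  where \<open>x = 2 * c * \<alpha>\<close>. This \<open>z\<close> minimizes the limiting exponent,
  and \<open>x \<ge> 1\<close> ensures \<open>z \<le> 1\<close>. The overshoot \<open>k\<close> is
  of lower order than \<open>J\<close> as \<open>\<theta>\<close> tends to 0.\<close>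

lemma large_component_whp:
  fixes V :: "nat \<Rightarrow> nat set" and H :: "nat \<Rightarrow> edge set" and D :: "nat \<Rightarrow> nat"
    and \<alpha> c d K :: real
  assumes V: "\<And>n. V n \<subseteq> {..<n}" and H: "\<And>n. H n \<subseteq> all_edges n" "\<And>n. H n \<subseteq> Pow (V n)"
    and deg: "\<And>n v. v \<in> V n \<Longrightarrow> D n \<le> card {w \<in> V n. {v, w} \<in> H n}"
    and DV: "\<And>n. D n \<le> card (V n)"
    and D_ge: "\<And>n. d * real n - K \<le> real (D n)"
    and V_le: "\<And>n. real (card (V n)) \<le> \<alpha> * real n + K"
    and c: "c > 0" and d: "d > 0" and x: "2 * c * \<alpha> \<ge> 1" and super: "1 + ln (2 * c * \<alpha>) < 2 * c * d"
  obtains \<delta> where "\<delta> > 0"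
    "(\<lambda>n. measure_pmf.prob (edge_process n (nat \<lfloor>c * real n\<rfloor>))
        {es. \<forall>v\<in>V n. real (card ((adj (set es \<inter> H n))\<^sup>* `` {v})) < \<delta> * real n}) \<longlonglongrightarrow> 0"
proof -
  define x where "x = 2 * c * \<alpha>"
  have x1: "x \<ge> 1" using x by (simp add: x_def)
  \<comment> \<open>\<open>\<theta> * g \<theta>\<close> is the limit of the exponent divided by
    \<open>n\<close>, and \<open>g\<close> tends to \<open>1 + ln x - 2 * c * d < 0\<close> at
    0.\<close>
  define g where "g = (\<lambda>\<theta>::real. (1 + \<theta>) * (ln x + 1) - 2 * ((d - (\<theta> + \<theta>\<^sup>2)) * (c - (\<theta> + \<theta>\<^sup>2))))"
  have "(g \<longlongrightarrow> (1 + 0) * (ln x + 1) - 2 * ((d - (0 + 0\<^sup>2)) * (c - (0 + 0\<^sup>2)))) (at_right 0)"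
    unfolding g_def by (intro tendsto_intros)
  moreover have "(1 + 0) * (ln x + 1) - 2 * ((d - (0 + 0\<^sup>2)) * (c - (0 + 0\<^sup>2))) < 0"
    using super by (simp add: x_def mult_ac)
  ultimately have "\<forall>\<^sub>F \<theta> in at_right 0. g \<theta> < 0"
    by (rule order_tendstoD)
  moreover have "((\<lambda>\<theta>::real. \<theta> + \<theta>\<^sup>2) \<longlongrightarrow> 0 + 0\<^sup>2) (at_right 0)"
    by (intro tendsto_intros)
  hence "\<forall>\<^sub>F \<theta> in at_right 0. \<theta> + \<theta>\<^sup>2 < min c d"
    using c d by (intro order_tendstoD) auto
  moreover have "\<forall>\<^sub>F \<theta>::real in at_right 0. \<theta> > 0"
    by (rule eventually_at_right_less)
  ultimately have "\<forall>\<^sub>F \<theta> in at_right 0. g \<theta> < 0 \<and> \<theta> + \<theta>\<^sup>2 < min c d \<and> \<theta> > 0"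
    by eventually_elim auto
  hence "\<exists>\<theta>. g \<theta> < 0 \<and> \<theta> + \<theta>\<^sup>2 < min c d \<and> \<theta> > 0"
    by (rule eventually_happens'[OF trivial_limit_at_right_real])
  then obtain \<theta> where \<theta>: "g \<theta> < 0" "\<theta> + \<theta>\<^sup>2 < c" "\<theta> + \<theta>\<^sup>2 < d" "\<theta> > 0"
    by auto
  \<comment> \<open>Half of the limiting decay rate, leaving room for the error of the
    limit.\<close>
  define \<gamma> where "\<gamma> = - (\<theta> * g \<theta>) / 2"
  have \<gamma>: "\<gamma> > 0"
    using \<theta> by (simp add: \<gamma>_def mult_pos_neg)
  define J where "J = (\<lambda>n. nat \<lceil>\<theta> * real n\<rceil>)"
  define k where "k = (\<lambda>n. nat \<lceil>\<theta>\<^sup>2 * real n\<rceil>)"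
  define m where "m = (\<lambda>n. nat \<lfloor>c * real n\<rfloor>)"
  define M where "M = (\<lambda>n. real (card (all_edges n)))"
  \<comment> \<open>The exponent of the bound, with \<open>D n\<close> and \<open>card (V n)\<close>
    replaced by their linear estimates.\<close>
  define U where "U = (\<lambda>n. real (J n + k n) * ln x + 1 / x * real (J n + k n) * real (m n) / M n * (\<alpha> * real n + K)
      - real (J n) * (d * real n - K - real (J n + k n)) / M n * (real (m n) - real (J n + k n)))"
  define P where "P = (\<lambda>n. measure_pmf.prob (edge_process n (m n))
        {es. \<forall>v\<in>V n. real (card ((adj (set es \<inter> H n))\<^sup>* `` {v})) < \<theta>\<^sup>2 * real n})"

  have lim_J: "(\<lambda>n. real (J n) / real n) \<longlonglongrightarrow> \<theta>"
    unfolding J_def using \<theta> by (intro tendsto_ceiling_div) auto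
  have lim_k: "(\<lambda>n. real (k n) / real n) \<longlonglongrightarrow> \<theta>\<^sup>2"
    unfolding k_def by (intro tendsto_ceiling_div) auto
  have lim_m: "(\<lambda>n. real (m n) / real n) \<longlonglongrightarrow> c"
    unfolding m_def using c by (intro tendsto_floor_div) auto
  have lim_B: "(\<lambda>n. real (J n + k n) / real n) \<longlonglongrightarrow> \<theta> + \<theta>\<^sup>2"
    using tendsto_add[OF lim_J lim_k] by (simp add: add_divide_distrib)
  have M_eq: "M n = real n * (real n - 1) / 2" for n
  proof -
    have "even (n * (n - 1))"
      by (cases n) auto
    hence "2 * (n choose 2) = n * (n - 1)"
      by (simp add: choose_two)
    hence "2 * M n = real (n * (n - 1))"
      by (metis M_def card_all_edges of_nat_mult of_nat_numeral)
    thus ?thesis by (cases n) (auto simp: algebra_simps)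
  qed
  have lim_M: "(\<lambda>n. (real n)\<^sup>2 / M n) \<longlonglongrightarrow> 2"
    unfolding M_eq by real_asymp
  have lim_K: "(\<lambda>n. K / real n) \<longlonglongrightarrow> 0"
    by real_asymp

  have lim_U: "(\<lambda>n. U n / real n) \<longlonglongrightarrow> \<theta> * g \<theta>"
  proof -
    have "(\<lambda>n. real (J n + k n) / real n * ln x
        + 1 / x * (real (J n + k n) / real n) * (real (m n) / real n) * ((real n)\<^sup>2 / M n) * (\<alpha> + K / real n)
        - real (J n) / real n * (d - K / real n - real (J n + k n) / real n) * ((real n)\<^sup>2 / M n)
          * (real (m n) / real n - real (J n + k n) / real n)) \<longlonglongrightarrow> 
       (\<theta> + \<theta>\<^sup>2) * ln x + 1 / x * (\<theta> + \<theta>\<^sup>2) * c * 2 * (\<alpha> + 0) - \<theta> * (d - 0 - (\<theta> + \<theta>\<^sup>2)) * 2 * (c - (\<theta> + \<theta>\<^sup>2))"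
      by (intro tendsto_intros lim_J lim_B lim_m lim_M lim_K)
    also have "(\<theta> + \<theta>\<^sup>2) * ln x + 1 / x * (\<theta> + \<theta>\<^sup>2) * c * 2 * (\<alpha> + 0) - \<theta> * (d - 0 - (\<theta> + \<theta>\<^sup>2)) * 2 * (c - (\<theta> + \<theta>\<^sup>2))
      = \<theta> * g \<theta>"
    proof -
      have "1 / x * (\<theta> + \<theta>\<^sup>2) * c * 2 * (\<alpha> + 0) = 1 / x * x * (\<theta> + \<theta>\<^sup>2)"
        by (simp add: x_def mult_ac)
      also have "\<dots> = \<theta> + \<theta>\<^sup>2"
        using x1 by simp
      finally show ?thesis
        by (simp add: g_def algebra_simps power2_eq_square)
    qed
    finally show ?thesis
    proof (rule Lim_transform_eventually)
      show "\<forall>\<^sub>F n in sequentially. real (J n + k n) / real n * ln x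
        + 1 / x * (real (J n + k n) / real n) * (real (m n) / real n) * ((real n)\<^sup>2 / M n) * (\<alpha> + K / real n)
        - real (J n) / real n * (d - K / real n - real (J n + k n) / real n) * ((real n)\<^sup>2 / M n)
          * (real (m n) / real n - real (J n + k n) / real n) = U n / real n"
        using eventually_gt_at_top[of 1]
      proof eventually_elim
        case (elim n)
        have e1: "\<alpha> + K / real n = (\<alpha> * real n + K) / real n"
             "d - K / real n - real (J n + k n) / real n = (d * real n - K - real (J n + k n)) / real n"
             "real (m n) / real n - real (J n + k n) / real n = (real (m n) - real (J n + k n)) / real n"
          using elim by (auto simp: field_simps)
        have rescale: "b / N * L + 1 / x * (b / N) * (p / N) * (N\<^sup>2 / T) * (W / N) - j / N * (Y / N) * (N\<^sup>2 / T) * (Z / N)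
            = (b * L + 1 / x * b * p / T * W - j * Y / T * Z) / N" if "N \<noteq> 0" for b L p N T W j Y Z :: real
          using that by (simp add: diff_divide_distrib add_divide_distrib power2_eq_square)
        show ?case
          unfolding e1 U_def using elim by (intro rescale) simp
      qed
    qed
  qed
  have "\<theta> * g \<theta> < - \<gamma>"
    using \<gamma> by (simp add: \<gamma>_def)
  hence ev_U: "\<forall>\<^sub>F n in sequentially. U n / real n < - \<gamma>"
    using lim_U by (intro order_tendstoD)
  have ev_m: "\<forall>\<^sub>F n in sequentially. real (J n + k n) / real n - real (m n) / real n < 0"
    using \<theta> by (intro order_tendstoD(2)[OF tendsto_diff[OF lim_B lim_m]]) auto
  have ev_D: "\<forall>\<^sub>F n in sequentially. real (J n + k n) / real n + K / real n < d"
    using \<theta> by (intro order_tendstoD(2)[OF tendsto_add[OF lim_B lim_K]]) auto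

  have "\<forall>\<^sub>F n in sequentially. P n \<le> (real n + 1) * exp (- \<gamma> * real n)"
    using ev_U ev_m ev_D eventually_ge_at_top[of 2]
  proof eventually_elim
    case (elim n)
    have "real (J n + k n) / real n < real (m n) / real n"
      using elim by simp
    hence Bm: "J n + k n \<le> m n"
      using elim by (simp add: divide_less_cancel del: of_nat_add)
    have BD': "real (J n + k n) + K \<le> d * real n"
      using elim by (simp add: field_simps)
    hence BD: "J n + k n \<le> D n"
      using D_ge[of n] by linarith
    have JV: "J n \<le> card (V n)"
      using BD DV[of n] by linarith
    have Mp: "M n > 0"
      using elim by (simp add: M_eq)
    define W where "W = (1 / (1 / x)) ^ (J n + k n) * exp (1 / x * real (J n + k n) * real (m n) / M n * real (card (V n)))
         * exp (- (real (J n) * (real (D n) - real (J n + k n)) / M n * (real (m n) - real (J n + k n))))"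
    have "P n \<le> measure_pmf.prob (edge_process n (m n))
        {es. \<forall>v\<in>V n. card ((adj (set es \<inter> H n))\<^sup>* `` {v}) \<le> k n}"
      unfolding P_def
    proof (rule measure_pmf.finite_measure_mono)
      \<comment> \<open>Rounding up in \<open>k\<close> turns the real bound on component sizes into
        the natural number bound of the previous section.\<close>
      have "a \<le> k n" if "real a < \<theta>\<^sup>2 * real n" for a
        using that unfolding k_def by linarith
      thus "{es. \<forall>v\<in>V n. real (card ((adj (set es \<inter> H n))\<^sup>* `` {v})) < \<theta>\<^sup>2 * real n}
        \<subseteq> {es. \<forall>v\<in>V n. card ((adj (set es \<inter> H n))\<^sup>* `` {v}) \<le> k n}"
        by auto
    qed auto
    also have "\<dots> \<le> (real n + 1) * W"
      unfolding W_def M_def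
      by (rule prob_no_large_component) (use elim V H deg JV BD Bm x1 in auto)
    also have "W = exp (real (J n + k n) * ln x + 1 / x * real (J n + k n) * real (m n) / M n * real (card (V n))
         - real (J n) * (real (D n) - real (J n + k n)) / M n * (real (m n) - real (J n + k n)))"
    proof -
      have "(1 / (1 / x)) ^ (J n + k n) = exp (real (J n + k n) * ln x)"
        using x1 by (simp only: exp_of_nat_mult) simp
      thus ?thesis
        unfolding W_def by (simp only: exp_add[symmetric]) simp
    qed
    also have "\<dots> \<le> exp (U n)"
    proof -
      have "1 / x * real (J n + k n) * real (m n) / M n * real (card (V n))
          \<le> 1 / x * real (J n + k n) * real (m n) / M n * (\<alpha> * real n + K)"
        using V_le[of n] x1 Mp by (intro mult_left_mono) auto
      moreover have "real (J n) * (d * real n - K - real (J n + k n)) / M n * (real (m n) - real (J n + k n))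
          \<le> real (J n) * (real (D n) - real (J n + k n)) / M n * (real (m n) - real (J n + k n))"
        using D_ge[of n] Bm Mp
        by (intro mult_right_mono divide_right_mono mult_left_mono) (auto simp del: of_nat_add)
      ultimately show ?thesis by (simp add: U_def)
    qed
    also have "\<dots> \<le> exp (- \<gamma> * real n)"
      using elim by (simp add: field_simps)
    finally show ?case by simp
  qed
  moreover have "\<forall>\<^sub>F n in sequentially. 0 \<le> P n"
    by (simp add: P_def)
  ultimately have "P \<longlonglongrightarrow> 0"
    by (intro tendsto_sandwich[OF _ _ tendsto_const tendsto_linear_times_exp_neg[OF \<gamma>]])
  thus ?thesis
    using that[of "\<theta>\<^sup>2"] \<theta> by (simp add: P_def m_def)
qed

section \<open>The colouring\<close>

text \<open>With \<open>s = sqrt x\<close>, \<open>1 + ln x = 1 + 2 * ln s\<close> is at most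
  \<open>2 * s - 1 = s\<^sup>2 - (s - 1)\<^sup>2\<close>, and the hypothesis says precisely that
  \<open>s / j < s - 1\<close>. Taking a square number of columns makes the degree loss
  \<open>1 / k\<close> fit this form.\<close>

lemma one_plus_ln_less:
  fixes x :: real and j :: nat
  assumes j: "j \<ge> 2" and x: "x > (real j / (real j - 1))\<^sup>2"
  shows "1 + ln x < x * (1 - 1 / (real j)\<^sup>2)"
proof -
  define s where "s = sqrt x"
  have j1: "real j - 1 > 0"
    using j by simp
  have x0: "x > 0"
    using x by (rule le_less_trans[rotated]) simp
  have s0: "s > 0" "x = s\<^sup>2"
    using x0 by (auto simp: s_def)
  have "real j / (real j - 1) < s"
    using x s0 by (metis less_imp_le power_less_imp_less_base)
  hence "real j < s * (real j - 1)"
    using j1 by (simp add: field_simps)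
  hence "s / real j < s - 1"
    using j by (simp add: field_simps)
  hence "(s / real j)\<^sup>2 < (s - 1)\<^sup>2"
    using s0 by (intro power_strict_mono) auto
  hence "2 * s - 1 < s\<^sup>2 * (1 - 1 / (real j)\<^sup>2)"
    by (simp add: power2_eq_square algebra_simps)
  moreover have "ln x = 2 * ln s"
    using s0 by (simp add: ln_realpow)
  moreover have "ln s \<le> s - 1"
    using s0 by (intro ln_le_minus_one)
  ultimately show ?thesis
    using s0 by simp
qed

text \<open>Pairs reserved for no colour default to 0, which is harmless: additional edges can only
  enlarge components.\<close>

definition line_colour :: "nat \<Rightarrow> nat \<Rightarrow> nat \<Rightarrow> nat \<Rightarrow> edge \<Rightarrow> nat" where
  "line_colour r k q n e = (if \<exists>i<r. e \<in> line_edges k q i n then SOME i. i < r \<and> e \<in> line_edges k q i n else 0)"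

lemma line_colour_less: "r > 0 \<Longrightarrow> line_colour r k q n e < r"
  unfolding line_colour_def by (auto intro: someI2_ex)

lemma line_colour_eq:
  assumes "\<And>t. 0 < t \<Longrightarrow> t < k \<Longrightarrow> coprime t q" "k > 0" "r \<le> q\<^sup>2" "i < r" "e \<in> line_edges k q i n"
  shows "line_colour r k q n e = i"
proof -
  have "(SOME i. i < r \<and> e \<in> line_edges k q i n) = i"
    using assms line_edges_unique[of k q _ i e n] by (intro some_equality) auto
  thus ?thesis
    using assms by (auto simp: line_colour_def)
qed

lemma run_online_oblivious: "run_online (\<lambda>_. f) es = map (\<lambda>e. (e, f e)) es"
  by (induction es rule: rev_induct) auto

text \<open>A line graph has relative size \<open>\<alpha> = 1 / q\<close> and relative minimum
  degree \<open>d = (1 - 1 / k) / q\<close>, up to an error of \<open>k\<close> vertices from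
  rounding to blocks. Hence \<open>x = 2 * c / q\<close>, and supercriticality is
  \<open>one_plus_ln_less\<close>.\<close>

lemma line_components_whp:
  fixes i j q :: nat and c :: real
  defines "k \<equiv> j\<^sup>2"
  assumes j: "j \<ge> 2" and q: "q > 0" and c: "c > (real j / (real j - 1))\<^sup>2 * real q / 2"
  shows "\<exists>\<delta>>0. (\<lambda>n. measure_pmf.prob (edge_process n (nat \<lfloor>c * real n\<rfloor>))
        {es. \<forall>v\<in>line_vertices k q i n.
           real (card ((adj (set es \<inter> line_edges k q i n))\<^sup>* `` {v})) < \<delta> * real n}) \<longlonglongrightarrow> 0"
proof -
  have k: "k > 0" "k > 1"
    using j by (auto simp: k_def power2_eq_square) (metis One_nat_def Suc_1 Suc_le_eq less_1_mult)
  define D where "D = (\<lambda>n. (k - 1) * (n div (k * q)))"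
  define \<alpha> where "\<alpha> = 1 / real q"
  define d where "d = (1 - 1 / real k) / real q"
  have x: "2 * c * \<alpha> > (real j / (real j - 1))\<^sup>2"
  proof -
    have "(real j / (real j - 1))\<^sup>2 * real q < 2 * c"
      using c by linarith
    thus ?thesis
      using q unfolding \<alpha>_def by (simp only: times_divide_eq_right mult_1_right pos_less_divide_eq of_nat_0_less_iff)
  qed
  have "1 \<le> real j / (real j - 1)"
    using j by (simp add: field_simps)
  hence j1: "1 \<le> (real j / (real j - 1))\<^sup>2"
    by (rule one_le_power)
  have c0: "c > 0"
    using x j1 q by (auto simp: \<alpha>_def zero_less_divide_iff zero_less_mult_iff dest: order.strict_trans1)
  have T: "real n / (real k * real q) - 1 \<le> real (n div (k * q))"
     "real (n div (k * q)) \<le> real n / (real k * real q)" for n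
  proof -
    have N: "real k * real q > 0"
      using k q by simp
    have "n = k * q * (n div (k * q)) + n mod (k * q)"
      by simp
    hence eq: "real n = real k * real q * real (n div (k * q)) + real (n mod (k * q))"
      by (metis of_nat_add of_nat_mult)
    have "n mod (k * q) < k * q"
      using k q by simp
    hence "real (n mod (k * q)) < real k * real q"
      by (metis of_nat_less_iff of_nat_mult)
    hence "real n \<le> (real (n div (k * q)) + 1) * (real k * real q)"
      by (subst eq) (simp add: algebra_simps)
    thus "real n / (real k * real q) - 1 \<le> real (n div (k * q))"
      using N by (simp add: pos_divide_le_eq diff_le_eq)
    have "real (n div (k * q)) * (real k * real q) \<le> real n"
      by (subst eq) (simp add: mult.commute)
    thus "real (n div (k * q)) \<le> real n / (real k * real q)"
      using N by (simp add: pos_le_divide_eq)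
  qed
  show ?thesis
  proof (rule large_component_whp[of "line_vertices k q i" "line_edges k q i" D d "real k" \<alpha> c])
    fix n
    show "line_vertices k q i n \<subseteq> {..<n}" "line_edges k q i n \<subseteq> all_edges n"
      "line_edges k q i n \<subseteq> Pow (line_vertices k q i n)"
      by (fact line_vertices_subset line_edges_subset)+
    show "D n \<le> card {w \<in> line_vertices k q i n. {v, w} \<in> line_edges k q i n}"
      if "v \<in> line_vertices k q i n" for v
    proof -
      have "finite {w \<in> line_vertices k q i n. {v, w} \<in> line_edges k q i n}"
        by (rule finite_subset[OF _ finite_lessThan[of n]]) (auto simp: line_vertices_def)
      from card_mono[OF this line_point_image_subset_neighbours[OF q that]] show ?thesis
        unfolding D_def card_line_point_image[OF q mod_less_divisor[OF k(1)]] .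
    qed
    have "D n \<le> k * (n div (k * q))"
      unfolding D_def by (intro mult_right_mono) auto
    thus "D n \<le> card (line_vertices k q i n)"
      using card_line_vertices_ge[OF q, of k n i] by linarith
    have "d * real n - real k \<le> (real k - 1) * (real n / (real k * real q) - 1)"
      using k q by (simp add: d_def field_simps)
    also have "\<dots> \<le> (real k - 1) * real (n div (k * q))"
      using T(1) k by (intro mult_left_mono) auto
    also have "\<dots> = real (D n)"
      using k by (simp add: D_def of_nat_diff)
    finally show "d * real n - real k \<le> real (D n)" .
    have "real (card (line_vertices k q i n)) \<le> real (k * (n div (k * q) + 1))"
      using card_line_vertices_le[OF k(1)] of_nat_le_iff by blast
    also have "\<dots> \<le> real k * (real n / (real k * real q) + 1)"
      using T(2)[of n] by (simp only: of_nat_mult of_nat_add of_nat_1) (intro mult_left_mono add_mono; simp)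
    also have "\<dots> = \<alpha> * real n + real k"
      using k q by (simp add: \<alpha>_def field_simps)
    finally show "real (card (line_vertices k q i n)) \<le> \<alpha> * real n + real k" .
  next
    show "c > 0" by fact
    show "d > 0"
      using k q by (simp add: d_def field_simps)
    show "1 \<le> 2 * c * \<alpha>"
      using x j1 by linarith
    show "1 + ln (2 * c * \<alpha>) < 2 * c * d"
      using one_plus_ln_less[OF j x] by (simp add: \<alpha>_def d_def k_def)
  qed blast
qed

text \<open>Colour class \<open>i\<close> contains every arrived edge of line \<open>i\<close>, so
  its components contain those of the line graph. A union bound over the fixed number of colours
  finishes the argument.\<close>

lemma line_colouring_whp:
  fixes r j q :: nat and c :: real
  defines "k \<equiv> j\<^sup>2"
  assumes r: "r > 0" "r \<le> q\<^sup>2" and j: "j \<ge> 2" and cop: "\<And>t. 0 < t \<Longrightarrow> t < k \<Longrightarrow> coprime t q"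
    and c: "c > (real j / (real j - 1))\<^sup>2 * real q / 2"
  shows "\<exists>\<delta>>0. (\<lambda>n. measure_pmf.prob (edge_process n (nat \<lfloor>c * real n\<rfloor>))
           {es. \<forall>i<r. \<exists>C\<in>connected_components {..<n}
                  (colour_class (run_online (\<lambda>_. line_colour r k q n) es) i).
                  real (card C) \<ge> \<delta> * real n}) \<longlonglongrightarrow> 1"
proof -
  have q: "q > 0"
    using r by (cases q) auto
  have k: "k > 0"
    using j by (simp add: k_def)
  define P where "P = (\<lambda>n. measure_pmf.prob (edge_process n (nat \<lfloor>c * real n\<rfloor>)))"
  define Bad where "Bad = (\<lambda>i \<delta> n. {es. \<forall>v\<in>line_vertices k q i n.
           real (card ((adj (set es \<inter> line_edges k q i n))\<^sup>* `` {v})) < \<delta> * real n})"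
  have "\<exists>\<delta>>0. (\<lambda>n. P n (Bad i \<delta> n)) \<longlonglongrightarrow> 0" for i
    using line_components_whp[OF j q c, of i] unfolding P_def Bad_def k_def by blast
  then obtain \<delta>' where \<delta>': "\<delta>' i > 0" "(\<lambda>n. P n (Bad i (\<delta>' i) n)) \<longlonglongrightarrow> 0" for i
    by metis
  define \<delta> where "\<delta> = Min (\<delta>' ` {..<r})"
  have \<delta>: "\<delta> > 0" "\<And>i. i < r \<Longrightarrow> \<delta> \<le> \<delta>' i"
    proof -
    show "\<delta> > 0"
      unfolding \<delta>_def using r \<delta>'(1) by (subst Min_gr_iff) auto
  qed (auto simp: \<delta>_def)
  define G where "G = (\<lambda>n. {es. \<forall>i<r. \<exists>C\<in>connected_components {..<n}
                  (colour_class (run_online (\<lambda>_. line_colour r k q n) es) i).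
                  real (card C) \<ge> \<delta> * real n})"
  have lower: "1 - (\<Sum>i<r. P n (Bad i (\<delta>' i) n)) \<le> P n (G n)" if n: "n \<ge> 2" for n
  proof -
    have ne: "all_edges n \<noteq> {}"
      using n card_all_edges[of n] by (auto simp: binomial_eq_0_iff)
    \<comment> \<open>On the support all edges stay inside \<open>{..<n}\<close>, so components are
      finite and \<open>card\<close> is monotone on them.\<close>
    have "- G n \<inter> set_pmf (edge_process n (nat \<lfloor>c * real n\<rfloor>)) \<subseteq> (\<Union>i\<in>{..<r}. Bad i (\<delta>' i) n)"
    proof
      fix es assume es: "es \<in> - G n \<inter> set_pmf (edge_process n (nat \<lfloor>c * real n\<rfloor>))"
      hence sub: "set es \<subseteq> all_edges n"
        using ne by (auto simp: edge_process_def set_replicate_pmf)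
      obtain i where i: "i < r" and small: "\<And>C. C \<in> connected_components {..<n}
          (colour_class (run_online (\<lambda>_. line_colour r k q n) es) i) \<Longrightarrow> real (card C) < \<delta> * real n"
        using es by (auto simp: G_def not_le)
      define E where "E = colour_class (run_online (\<lambda>_. line_colour r k q n) es) i"
      have E: "E = {e \<in> set es. line_colour r k q n e = i}"
        by (auto simp: E_def colour_class_def run_online_oblivious)
      have "real (card ((adj (set es \<inter> line_edges k q i n))\<^sup>* `` {v})) < \<delta>' i * real n"
        if v: "v \<in> line_vertices k q i n" for v
      proof -
        have "adj (set es \<inter> line_edges k q i n) \<subseteq> adj E"
          using line_colour_eq[OF cop k r(2) i] by (auto simp: adj_def E)
        hence "(adj (set es \<inter> line_edges k q i n))\<^sup>* `` {v} \<subseteq> (adj E)\<^sup>* `` {v}"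
          by (intro Image_mono rtrancl_mono) auto
        moreover have "(adj E)\<^sup>* `` {v} \<subseteq> {..<n}"
        proof -
          have "adj E \<subseteq> {..<n} \<times> {..<n}"
            using sub by (auto simp: adj_def E all_edges_def)
          thus ?thesis
            using v line_vertices_subset[of k q i n] by (auto elim: rtranclE)
        qed
        hence "finite ((adj E)\<^sup>* `` {v})"
          by (rule finite_subset) simp
        ultimately have "card ((adj (set es \<inter> line_edges k q i n))\<^sup>* `` {v}) \<le> card ((adj E)\<^sup>* `` {v})"
          by (intro card_mono)
        moreover have "(adj E)\<^sup>* `` {v} \<in> connected_components {..<n} E"
          using v line_vertices_subset[of k q i n] by (auto simp: connected_components_def adj_def)
        hence "real (card ((adj E)\<^sup>* `` {v})) < \<delta> * real n"
          using small by (simp add: E_def)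
        moreover have "\<delta> * real n \<le> \<delta>' i * real n"
          using \<delta>(2)[OF i] by (intro mult_right_mono) auto
        ultimately show ?thesis by linarith
      qed
      hence "es \<in> Bad i (\<delta>' i) n"
        by (simp add: Bad_def)
      thus "es \<in> (\<Union>i\<in>{..<r}. Bad i (\<delta>' i) n)"
        using i by blast
    qed
    hence "P n (- G n) \<le> P n (\<Union>i\<in>{..<r}. Bad i (\<delta>' i) n)"
      unfolding P_def by (subst measure_Int_set_pmf[symmetric]) (auto intro: measure_pmf.finite_measure_mono)
    also have "\<dots> \<le> (\<Sum>i<r. P n (Bad i (\<delta>' i) n))"
      unfolding P_def by (intro measure_UNION_le) auto
    finally show ?thesis
      using measure_pmf.prob_compl[of "G n" "edge_process n (nat \<lfloor>c * real n\<rfloor>)"]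
      by (simp add: P_def Compl_eq_Diff_UNIV)
  qed
  have "(\<lambda>n. P n (G n)) \<longlonglongrightarrow> 1"
  proof (rule tendsto_sandwich)
    have "(\<lambda>n. 1 - (\<Sum>i<r. P n (Bad i (\<delta>' i) n))) \<longlonglongrightarrow> 1 - (\<Sum>i<r. 0)"
      using \<delta>'(2) by (intro tendsto_intros)
    thus "(\<lambda>n. 1 - (\<Sum>i<r. P n (Bad i (\<delta>' i) n))) \<longlonglongrightarrow> 1"
      by simp
    show "\<forall>\<^sub>F n in sequentially. 1 - (\<Sum>i<r. P n (Bad i (\<delta>' i) n)) \<le> P n (G n)"
      using eventually_ge_at_top[of 2] by eventually_elim (rule lower)
  qed (auto simp: P_def)
  thus ?thesis
    using \<delta>(1) unfolding P_def G_def by blast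
qed

text \<open>Being congruent to \<open>1\<close> modulo \<open>(j\<^sup>2)!\<close>, it is coprime to all differences of columns, with no need for
  primes close to \<open>sqrt r\<close>.\<close>
definition line_order :: "nat \<Rightarrow> nat \<Rightarrow> nat" where
  "line_order j r = 1 + fact (j\<^sup>2) * nat \<lceil>sqrt (real r) / fact (j\<^sup>2)\<rceil>"

text \<open>Rounding up to a multiple of \<open>fact (j\<^sup>2)\<close> costs an amount independent
  of \<open>r\<close>, hence negligible against \<open>sqrt r\<close> for fixed
  \<open>j\<close>.\<close>

lemma line_order_bounds:
  "sqrt (real r) \<le> real (line_order j r)"
  "real (line_order j r) \<le> sqrt (real r) + (fact (j\<^sup>2) + 1)"
proof -
  define F :: real where "F = fact (j\<^sup>2)"
  have F: "F > 0"
    by (simp add: F_def)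
  have eq: "real (line_order j r) = 1 + F * real (nat \<lceil>sqrt (real r) / F\<rceil>)"
    by (simp add: line_order_def F_def)
  have "sqrt (real r) / F \<le> real (nat \<lceil>sqrt (real r) / F\<rceil>)"
    by (rule real_nat_ceiling_ge)
  thus "sqrt (real r) \<le> real (line_order j r)"
    using F unfolding eq by (simp only: pos_divide_le_eq) (simp add: mult.commute)
  have "0 \<le> sqrt (real r) / F"
    using F by simp
  hence "real (nat \<lceil>sqrt (real r) / F\<rceil>) \<le> sqrt (real r) / F + 1"
    by linarith
  hence "F * real (nat \<lceil>sqrt (real r) / F\<rceil>) \<le> F * (sqrt (real r) / F + 1)"
    using F by (intro mult_left_mono) auto
  thus "real (line_order j r) \<le> sqrt (real r) + (fact (j\<^sup>2) + 1)"
    using F by (simp add: eq distrib_left) (simp add: F_def)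
qed

text \<open>A divisor of \<open>t\<close> divides \<open>fact (j\<^sup>2)\<close>, so a common
  divisor with \<open>line_order j r\<close> divides the summand 1.\<close>

lemma coprime_line_order:
  assumes "0 < t" "t < j\<^sup>2"
  shows "coprime t (line_order j r)"
proof (rule coprimeI)
  fix d assume d: "d dvd t" "d dvd line_order j r"
  have "t dvd fact (j\<^sup>2)"
    using assms by (intro dvd_fact) auto
  hence "d dvd fact (j\<^sup>2) * nat \<lceil>sqrt (real r) / fact (j\<^sup>2)\<rceil>"
    using d(1) by (meson dvd_mult2 dvd_trans)
  thus "is_unit d"
    using d(2) unfolding line_order_def by (metis dvd_add_left_iff)
qed

section \<open>The constant and its asymptotics\<close>

definition rounds_per_vertex :: "nat \<Rightarrow> nat \<Rightarrow> real" where
  "rounds_per_vertex j r = (real j / (real j - 1))\<^sup>2 * real (line_order j r) / 2"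

lemma rounds_per_vertex_ge:
  assumes "j \<ge> 2"
  shows "sqrt (real r) / 2 \<le> rounds_per_vertex j r"
proof -
  have "1 \<le> real j / (real j - 1)"
    using assms by (simp add: field_simps)
  hence "1 * sqrt (real r) \<le> (real j / (real j - 1))\<^sup>2 * real (line_order j r)"
    using line_order_bounds(1) by (intro mult_mono one_le_power) auto
  thus ?thesis
    by (simp add: rounds_per_vertex_def)
qed

lemma rounds_per_vertex_le:
  assumes "r > 0"
  shows "rounds_per_vertex j r / (sqrt (real r) / 2)
    \<le> (real j / (real j - 1))\<^sup>2 * (1 + (fact (j\<^sup>2) + 1) / sqrt (real r))"
proof -
  have "real (line_order j r) / sqrt (real r) \<le> (sqrt (real r) + (fact (j\<^sup>2) + 1)) / sqrt (real r)"
    by (intro divide_right_mono line_order_bounds(2)) auto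
  also have "\<dots> = 1 + (fact (j\<^sup>2) + 1) / sqrt (real r)"
    using assms by (simp add: add_divide_distrib)
  finally have "(real j / (real j - 1))\<^sup>2 * (real (line_order j r) / sqrt (real r))
     \<le> (real j / (real j - 1))\<^sup>2 * (1 + (fact (j\<^sup>2) + 1) / sqrt (real r))"
    by (rule mult_left_mono) simp
  thus ?thesis
    by (simp add: rounds_per_vertex_def)
qed

text \<open>Minimizing over \<open>j\<close> replaces an explicit choice of \<open>j\<close> growing slowly with \<open>r\<close>.\<close>
lemma Min_rounds_per_vertex_asymp_equiv:
  "(\<lambda>r. Min ((\<lambda>j. rounds_per_vertex j r) ` {2..2 + r})) \<sim>[at_top] (\<lambda>r. sqrt (real r) / 2)"
proof (rule asymp_equivI', rule order_tendstoI)
  fix a :: real assume a: "a < 1"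
  have "a < Min ((\<lambda>j. rounds_per_vertex j r) ` {2..2 + r}) / (sqrt (real r) / 2)" if r: "r > 0" for r
  proof -
    have "sqrt (real r) / 2 \<le> Min ((\<lambda>j. rounds_per_vertex j r) ` {2..2 + r})"
      by (intro Min.boundedI) (use rounds_per_vertex_ge[of _ r] in auto)
    hence "1 \<le> Min ((\<lambda>j. rounds_per_vertex j r) ` {2..2 + r}) / (sqrt (real r) / 2)"
      using r by (subst le_divide_eq_1_pos) auto
    thus ?thesis using a by linarith
  qed
  thus "\<forall>\<^sub>F r in at_top. a < Min ((\<lambda>j. rounds_per_vertex j r) ` {2..2 + r}) / (sqrt (real r) / 2)"
    using eventually_gt_at_top[of 0] by (rule eventually_mono[rotated]) auto
next
  fix a :: real assume a: "1 < a"
  \<comment> \<open>First \<open>j\<close> is fixed so that the limiting ratio is below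
    \<open>a\<close>; only then does \<open>r\<close> grow.\<close>
  have "(\<lambda>j. (real j / (real j - 1))\<^sup>2) \<longlonglongrightarrow> 1"
    by real_asymp
  hence "\<forall>\<^sub>F j in sequentially. (real j / (real j - 1))\<^sup>2 < a \<and> j \<ge> 2"
    using order_tendstoD(2) a eventually_ge_at_top[of 2] eventually_conj by blast
  then obtain j where j: "(real j / (real j - 1))\<^sup>2 < a" "j \<ge> 2"
    using eventually_happens' sequentially_bot by blast
  have "(\<lambda>r. (real j / (real j - 1))\<^sup>2 * (1 + (fact (j\<^sup>2) + 1) / sqrt (real r))) \<longlonglongrightarrow> 
     (real j / (real j - 1))\<^sup>2 * (1 + 0)"
  proof (intro tendsto_intros)
    show "(\<lambda>r. (fact (j\<^sup>2) + 1) / sqrt (real r)) \<longlonglongrightarrow> 0"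
      by (rule real_tendsto_divide_at_top[OF tendsto_const]) real_asymp
  qed
  hence "\<forall>\<^sub>F r in sequentially. (real j / (real j - 1))\<^sup>2 * (1 + (fact (j\<^sup>2) + 1) / sqrt (real r)) < a"
    using j by (intro order_tendstoD(2)) auto
  thus "\<forall>\<^sub>F r in at_top. Min ((\<lambda>j. rounds_per_vertex j r) ` {2..2 + r}) / (sqrt (real r) / 2) < a"
    \<comment> \<open>\<open>r \<ge> j\<close> places \<open>j\<close> in the range of the
      minimum.\<close>
    using eventually_ge_at_top[of "max 1 j"]
  proof eventually_elim
    case (elim r)
    have "Min ((\<lambda>j. rounds_per_vertex j r) ` {2..2 + r}) \<le> rounds_per_vertex j r"
      using elim j by (intro Min_le) auto
    hence "Min ((\<lambda>j. rounds_per_vertex j r) ` {2..2 + r}) / (sqrt (real r) / 2)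
        \<le> rounds_per_vertex j r / (sqrt (real r) / 2)"
      by (rule divide_right_mono) auto
    also have "\<dots> < a"
      using rounds_per_vertex_le[of r j] elim by linarith
    finally show ?case .
  qed
qed

theorem theorem1p5:
  shows "\<exists>c :: nat \<Rightarrow> real. c \<sim>[at_top] (\<lambda>r. sqrt (real r) / 2) \<and>
    (\<forall>r\<ge>2. \<exists>A :: nat \<Rightarrow> online_algorithm.
      (\<forall>n. uses_colours r (A n)) \<and>
      (\<forall>\<epsilon>>0. \<exists>\<delta>>0.
        (\<lambda>n. measure_pmf.prob (edge_process n (nat \<lfloor>(c r + \<epsilon>) * real n\<rfloor>))
           {es. \<forall>i<r. \<exists>C\<in>connected_components {..<n} (colour_class (run_online (A n) es) i).
                  real (card C) \<ge> \<delta> * real n}) \<longlonglongrightarrow> 1))"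
proof (intro exI[of _ "\<lambda>r. Min ((\<lambda>j. rounds_per_vertex j r) ` {2..2 + r})"] conjI allI impI)
  show "(\<lambda>r. Min ((\<lambda>j. rounds_per_vertex j r) ` {2..2 + r})) \<sim>[at_top] (\<lambda>r. sqrt (real r) / 2)"
    by (rule Min_rounds_per_vertex_asymp_equiv)
next
  fix r :: nat assume r: "r \<ge> 2"
  \<comment> \<open>The minimizing \<open>j\<close> depends on \<open>r\<close> alone, so the
    algorithm is fixed before \<open>\<epsilon>\<close> is given.\<close>
  have "Min ((\<lambda>j. rounds_per_vertex j r) ` {2..2 + r}) \<in> (\<lambda>j. rounds_per_vertex j r) ` {2..2 + r}"
    by (intro Min_in) auto
  then obtain j where Min_eq: "Min ((\<lambda>j. rounds_per_vertex j r) ` {2..2 + r}) = rounds_per_vertex j r"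
    and "j \<in> {2..2 + r}"
    by (rule imageE)
  hence j: "j \<ge> 2"
    by simp
  define q where "q = line_order j r"
  have "real r = (sqrt (real r))\<^sup>2"
    by simp
  also have "\<dots> \<le> (real q)\<^sup>2"
    unfolding q_def by (intro power_mono line_order_bounds) auto
  finally have rq: "r \<le> q\<^sup>2"
    by (metis of_nat_le_iff of_nat_power)
  define A where "A = (\<lambda>n (_ :: (edge \<times> nat) list). line_colour r (j\<^sup>2) q n)"
  have whp: "\<exists>\<delta>>0. (\<lambda>n. measure_pmf.prob
        (edge_process n (nat \<lfloor>(Min ((\<lambda>j. rounds_per_vertex j r) ` {2..2 + r}) + \<epsilon>) * real n\<rfloor>))
           {es. \<forall>i<r. \<exists>C\<in>connected_components {..<n} (colour_class (run_online (A n) es) i).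
                  real (card C) \<ge> \<delta> * real n}) \<longlonglongrightarrow> 1" if "\<epsilon> > 0" for \<epsilon> :: real
    unfolding A_def Min_eq
    by (rule line_colouring_whp)
       (use r rq j that in \<open>auto simp: rounds_per_vertex_def q_def coprime_line_order\<close>)
  have "uses_colours r (A n)" for n
    using r by (simp add: uses_colours_def A_def line_colour_less)
  thus "\<exists>A :: nat \<Rightarrow> online_algorithm.
      (\<forall>n. uses_colours r (A n)) \<and>
      (\<forall>\<epsilon>>0. \<exists>\<delta>>0.
        (\<lambda>n. measure_pmf.prob
           (edge_process n (nat \<lfloor>(Min ((\<lambda>j. rounds_per_vertex j r) ` {2..2 + r}) + \<epsilon>) * real n\<rfloor>))
           {es. \<forall>i<r. \<exists>C\<in>connected_components {..<n} (colour_class (run_online (A n) es) i).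
                  real (card C) \<ge> \<delta> * real n}) \<longlonglongrightarrow> 1)"
    using whp by blast
qed

end
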